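(* Let $m=(m(n))_{n\ge0}$ be a sequence of moments. Let $$P(\xi,z,\zeta)=P_0(z,\zeta)+P_1(z,\zeta)\xi+\dots+P_p(z,\zeta)\xi^p\qquad (z\in D,\ \xi,\zeta\in\mathbb{C})$$ be a polynomial in the two variables $(\xi,\zeta)$ with coefficients in $\mathbb{E}$ depending on $z$, of order $p$ with respect to $\xi$, and let $\hat{f}(\varepsilon,z)=\sum_{n=0}^\infty f_n(z)\varepsilon^n\in\mathbb{E}[[\varepsilon]]$. Let $\hat{x}(\varepsilon,z)=\sum_{n=0}^\infty x_n(z)\varepsilon^n\in\mathbb{E}[[\varepsilon]]$. Then $\hat{x}$ is a formal power series solution of the singularly perturbed equation $$P(\varepsilon,z,\partial_{m,z})\hat{x}(\varepsilon,z)=\hat{f}(\varepsilon,z)$$ if and only if its Borel transform $\hat{y}(\varepsilon,z):=\hat{\mathcal{B}}_{1,\varepsilon}\hat{x}(\varepsilon,z)$ is a formal solution of the Cauchy problem $$\begin{cases}Q(\partial_\varepsilon,z,\partial_{m,z})\hat{y}(\varepsilon,z)=\hat{F}(\varepsilon,z)\\ \partial_\varepsilon^n\hat{y}(0,z)=x_n(z)\quad\text{for } n=0,1,\dots,p-1,\end{cases}$$ where $Q(\partial_\varepsilon,z,\partial_{m,z}):=\partial_\varepsilon^pP(\partial_\varepsilon^{-1},z,\partial_{m,z})$ (i.e. $Q(\chi,z,\zeta)=\chi^pP(\chi^{-1},z,\zeta)$), $\hat{F}(\varepsilon,z):=\partial_\varepsilon^p\hat{\mathcal{B}}_{1,\varepsilon}\hat{f}(\varepsilon,z)$,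 and the functions $x_0(z),\dots,x_{p-1}(z)$ satisfy the equations $$P_n(z,\partial_{m,z})x_0(z)+P_{n-1}(z,\partial_{m,z})x_1(z)+\dots+P_0(z,\partial_{m,z})x_n(z)=f_n(z)\quad\text{for } n=0,\dots,p-1.$$
   Context: $D$ is an open disc centred at $0\in\mathbb{C}$. Here $\mathbb{E}$ is the space $\mathcal{O}$ of functions of $z$ holomorphic on a disc $D_r$ and continuous on its closure for some $r>0$ (sup norm; the radius is not prescribed and may be decreased if necessary), and $\mathbb{E}[[\varepsilon]]$ is the space of formal power series in $\varepsilon$ with coefficients in $\mathbb{E}$. In $P_j(z,\partial_{m,z})$ a monomial $c(z)\zeta^i$ is replaced by the operator $c(z)\partial_{m,z}^i$, acting on coefficients of series in $\varepsilon$. The formal Borel transform is $\hat{\mathcal{B}}_{1,\varepsilon}\left(\sum_{n\ge0}u_n\varepsilon^n\right)=\sum_{n\ge0}\frac{u_n}{n!}\varepsilon^n$; $\partial_\varepsilon$ is formal differentiation in $\varepsilon$. The requirement that $x_0,\dots,x_{p-1}$ satisfy the displayed equations is part of the right-hand side of the equivalence. The moment differential operator is $\partial_{m,z}\left(\sum_{n\ge0}\frac{a_n}{m(n)}z^n\right)=\sum_{n\ge0}\frac{a_{n+1}}{m(n)}z^n$. Sequence of moments: write $S(\theta,\alpha)=\{\rho e^{i\phi}:\rho>0,|\phi-\theta|<\alpha/2\}$. A pair $e(t),E(t)$ is a pair of kernel functions of order $K>\frac12$ if: $e$ is holomorphic in $S(0,\pi/K)$ and $t^{-1}e(t)$ is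 integrable at the origin, i.e. $\int_0^{x_0}x^{-1}|e(xe^{i\tau})|\,dx<\infty$ for all $x_0>0$ and $2K|\tau|<\pi$; for each $\delta>0$ there are $c,L>0$ with $|e(t)|\le c\exp[-(|t|/L)^K]$ for $2K|\arg t|\le\pi-\delta$; $e(x)>0$ for $x>0$; $E$ is entire with $|E(t)|\le Me^{N|t|^K}$ for some $M,N>0$, and $t^{-1}E(1/t)$ is integrable at the origin in $S(\pi,\pi(2-\frac1K))$; and $E(t)=\sum_{n\ge0}\frac{t^n}{m(n)}$, where $m(u)=\int_0^\infty x^{u-1}e(x)\,dx$ ($\mathrm{Re}\,u\ge0$) is the moment function of order $\frac1K$, normalized by $m(0)=1$. For $K\le\frac12$, take $p'\in\mathbb{N}$ with $p'K>\frac12$; $e,E$ are kernel functions of order $K$ if there are kernel functions $\tilde e,\tilde E$ of order $p'K$ with moment function $\tilde m$ such that $e(t)=\tilde e(t^{1/p'})/p'$ and $E(t)=\sum_n t^n/\tilde m(p'n)$, the moment function being $m(u)=\tilde m(p'u)$. A sequence of moments (of order $\frac1K$) is $m=(m(n))_{n\ge0}$ with $m(u)$ a moment function (of order $\frac1K$). *)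

theory Defs
  imports
    "HOL-Complex_Analysis.Complex_Analysis"
    "HOL-Computational_Algebra.Computational_Algebra"
begin

definition hol_disc :: "real \<Rightarrow> (complex \<Rightarrow> complex) set" where
  "hol_disc r = {f. f holomorphic_on ball 0 r \<and> continuous_on (cball 0 r) f}"

definition hol_near_0 :: "(complex \<Rightarrow> complex) set" where
  "hol_near_0 = (\<Union>r\<in>{0<..}. hol_disc r)"

definition germ_rel :: "(complex \<Rightarrow> complex) \<Rightarrow> (complex \<Rightarrow> complex) \<Rightarrow> bool" where
  "germ_rel f g \<longleftrightarrow> f \<in> hol_near_0 \<and> g \<in> hol_near_0 \<and> (\<forall>\<^sub>F z in nhds 0. f z = g z)"

lemma hol_near_0_iff:
  "f \<in> hol_near_0 \<longleftrightarrow> (\<exists>r>0. f holomorphic_on ball 0 r \<and> continuous_on (cball 0 r) f)"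
  by (auto simp: hol_near_0_def hol_disc_def)

lemma hol_near_0_const: "(\<lambda>_. c) \<in> hol_near_0"
  unfolding hol_near_0_iff by (intro exI[of _ 1]) auto

lemma hol_near_0_binop:
  assumes f: "f \<in> hol_near_0" and g: "g \<in> hol_near_0"
    and hol: "\<And>A. f holomorphic_on A \<Longrightarrow> g holomorphic_on A \<Longrightarrow> (\<lambda>z. h (f z) (g z)) holomorphic_on A"
    and cont: "\<And>A. continuous_on A f \<Longrightarrow> continuous_on A g \<Longrightarrow> continuous_on A (\<lambda>z. h (f z) (g z))"
  shows "(\<lambda>z. h (f z) (g z)) \<in> hol_near_0"
proof -
  from f obtain r where r: "r > 0" "f holomorphic_on ball 0 r" "continuous_on (cball 0 r) f"
    by (auto simp: hol_near_0_iff)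
  from g obtain s where s: "s > 0" "g holomorphic_on ball 0 s" "continuous_on (cball 0 s) g"
    by (auto simp: hol_near_0_iff)
  have "(\<lambda>z. h (f z) (g z)) holomorphic_on ball 0 (min r s)"
    by (rule hol; rule holomorphic_on_subset[OF r(2)] holomorphic_on_subset[OF s(2)]) auto
  moreover have "continuous_on (cball 0 (min r s)) (\<lambda>z. h (f z) (g z))"
    by (rule cont; rule continuous_on_subset[OF r(3)] continuous_on_subset[OF s(3)]) auto
  ultimately show ?thesis
    unfolding hol_near_0_iff using r(1) s(1) by (intro exI[of _ "min r s"]) auto
qed

lemma hol_near_0_plus: "f \<in> hol_near_0 \<Longrightarrow> g \<in> hol_near_0 \<Longrightarrow> (\<lambda>z. f z + g z) \<in> hol_near_0"
  by (rule hol_near_0_binop) (auto intro!: holomorphic_intros continuous_intros)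

lemma hol_near_0_minus: "f \<in> hol_near_0 \<Longrightarrow> g \<in> hol_near_0 \<Longrightarrow> (\<lambda>z. f z - g z) \<in> hol_near_0"
  by (rule hol_near_0_binop) (auto intro!: holomorphic_intros continuous_intros)

lemma hol_near_0_times: "f \<in> hol_near_0 \<Longrightarrow> g \<in> hol_near_0 \<Longrightarrow> (\<lambda>z. f z * g z) \<in> hol_near_0"
  by (rule hol_near_0_binop) (auto intro!: holomorphic_intros continuous_intros)

lemma hol_near_0_uminus: "f \<in> hol_near_0 \<Longrightarrow> (\<lambda>z. - f z) \<in> hol_near_0"
  using hol_near_0_minus[OF hol_near_0_const[of 0], of f] by simp

lemma hol_near_0_scaleR: "f \<in> hol_near_0 \<Longrightarrow> (\<lambda>z. c *\<^sub>R f z) \<in> hol_near_0"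
  using hol_near_0_times[OF hol_near_0_const[of "of_real c"], of f] by (simp add: scaleR_conv_of_real)

lemmas hol_near_0_intros =
  hol_near_0_const hol_near_0_plus hol_near_0_minus hol_near_0_times hol_near_0_uminus hol_near_0_scaleR

text \<open>
  Since the radius is not prescribed and may be decreased, two functions represent the same
  element of the space iff they agree on some neighbourhood of the origin.
\<close>

quotient_type germ = "complex \<Rightarrow> complex" / partial: germ_rel
proof (rule part_equivpI)
  show "\<exists>f. germ_rel f f"
    using hol_near_0_const[of 0] by (auto simp: germ_rel_def)
  show "symp germ_rel"
    by (auto simp: symp_def germ_rel_def elim: eventually_mono)
  show "transp germ_rel"
    unfolding transp_def germ_rel_def by (auto elim: eventually_elim2)
qed

instantiation germ :: comm_ring_1
begin

lift_definition zero_germ :: germ is "\<lambda>_. 0"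
  by (auto simp: germ_rel_def hol_near_0_const)

lift_definition one_germ :: germ is "\<lambda>_. 1"
  by (auto simp: germ_rel_def hol_near_0_const)

lift_definition plus_germ :: "germ \<Rightarrow> germ \<Rightarrow> germ" is "\<lambda>f g z. f z + g z"
  unfolding germ_rel_def by (auto intro!: hol_near_0_intros elim: eventually_elim2)

lift_definition minus_germ :: "germ \<Rightarrow> germ \<Rightarrow> germ" is "\<lambda>f g z. f z - g z"
  unfolding germ_rel_def by (auto intro!: hol_near_0_intros elim: eventually_elim2)

lift_definition times_germ :: "germ \<Rightarrow> germ \<Rightarrow> germ" is "\<lambda>f g z. f z * g z"
  unfolding germ_rel_def by (auto intro!: hol_near_0_intros elim: eventually_elim2)

lift_definition uminus_germ :: "germ \<Rightarrow> germ" is "\<lambda>f z. - f z"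
  unfolding germ_rel_def by (auto intro!: hol_near_0_intros elim: eventually_mono)

instance
proof
  show "(0 :: germ) \<noteq> 1"
    by transfer (simp add: germ_rel_def)
qed (transfer; simp add: germ_rel_def algebra_simps hol_near_0_intros)+

end

instantiation germ :: real_algebra_1
begin

lift_definition scaleR_germ :: "real \<Rightarrow> germ \<Rightarrow> germ" is "\<lambda>c f z. c *\<^sub>R f z"
  unfolding germ_rel_def by (auto intro!: hol_near_0_intros elim: eventually_mono)

instance
  by standard (transfer; simp add: germ_rel_def scaleR_add_left scaleR_add_right hol_near_0_intros)+

end

lift_definition taylor_coeff :: "germ \<Rightarrow> nat \<Rightarrow> complex" is "\<lambda>f n. (deriv ^^ n) f 0 / fact n"
proof (rule ext)
  fix f g :: "complex \<Rightarrow> complex" and n :: nat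
  assume "germ_rel f g"
  then have "\<forall>\<^sub>F z in nhds 0. f z = g z" by (simp add: germ_rel_def)
  then show "(deriv ^^ n) f 0 / fact n = (deriv ^^ n) g 0 / fact n"
    using higher_deriv_cong_ev[of f g 0 0 n] by simp
qed

definition sector :: "real \<Rightarrow> real \<Rightarrow> complex set" where
  "sector \<theta> \<alpha> = {complex_of_real \<rho> * cis \<phi> | \<rho> \<phi>. \<rho> > 0 \<and> \<bar>\<phi> - \<theta>\<bar> < \<alpha> / 2}"

text \<open>Integrability at the origin, in the sector of direction \<open>\<theta>\<close> and opening \<open>\<alpha>\<close>, of
  \<open>t\<inverse> g t\<close> (not of \<open>g\<close> itself).\<close>

definition integrable_at_origin :: "real \<Rightarrow> real \<Rightarrow> (complex \<Rightarrow> complex) \<Rightarrow> bool" where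
  "integrable_at_origin \<theta> \<alpha> g \<longleftrightarrow>
     (\<forall>x\<^sub>0>0. \<forall>\<tau>. \<bar>\<tau> - \<theta>\<bar> < \<alpha> / 2 \<longrightarrow>
        set_integrable lborel {0<..x\<^sub>0} (\<lambda>x. cmod (g (complex_of_real x * cis \<tau>)) / x))"

definition mellin :: "(complex \<Rightarrow> complex) \<Rightarrow> complex \<Rightarrow> complex" where
  "mellin e u = (LBINT x:{0<..}. complex_of_real x powr (u - 1) * e (complex_of_real x))"

text \<open>Pairs of kernel functions of order \<open>K > 1/2\<close> together with their moment function, which matters
  only on the closed right half-plane.\<close>

definition kernel_pair ::
    "real \<Rightarrow> (complex \<Rightarrow> complex) \<Rightarrow> (complex \<Rightarrow> complex) \<Rightarrow> (complex \<Rightarrow> complex) \<Rightarrow> bool" where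
  "kernel_pair K e E m \<longleftrightarrow>
     K > 1/2 \<and>
     e holomorphic_on sector 0 (pi / K) \<and>
     integrable_at_origin 0 (pi / K) e \<and>
     (\<forall>\<delta>>0. \<exists>c>0. \<exists>L>0. \<forall>t. t \<noteq> 0 \<and> 2 * K * \<bar>Arg t\<bar> \<le> pi - \<delta> \<longrightarrow>
        cmod (e t) \<le> c * exp (- ((cmod t / L) powr K))) \<and>
     (\<forall>x>0. e (complex_of_real x) \<in> \<real> \<and> Re (e (complex_of_real x)) > 0) \<and>
     E holomorphic_on UNIV \<and>
     (\<exists>M>0. \<exists>N>0. \<forall>t. cmod (E t) \<le> M * exp (N * cmod t powr K)) \<and>
     integrable_at_origin pi (pi * (2 - 1 / K)) (\<lambda>t. E (1 / t)) \<and>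
     (\<forall>u. Re u \<ge> 0 \<longrightarrow> m u = mellin e u) \<and>
     (\<forall>t. (\<lambda>n. t ^ n / m (of_nat n)) sums E t) \<and>
     m 0 = 1"

text \<open>For \<open>K \<le> 1/2\<close> the kernel \<open>e\<close> lives on a sector of opening at least \<open>2\<pi>\<close>, i.e. on the Riemann
  surface of the logarithm. It is therefore a function of the polar coordinates \<open>\<rho>\<close>, \<open>\<phi>\<close>, in which
  \<open>t\<^bsup>1/p\<^esup>\<close> is \<open>\<rho>\<^bsup>1/p\<^esup> cis (\<phi>/p)\<close>.\<close>

definition kernel_pair_small ::
    "real \<Rightarrow> (real \<Rightarrow> real \<Rightarrow> complex) \<Rightarrow> (complex \<Rightarrow> complex) \<Rightarrow> (complex \<Rightarrow> complex) \<Rightarrow> bool" where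
  "kernel_pair_small K e E m \<longleftrightarrow>
     0 < K \<and> K \<le> 1/2 \<and>
     (\<exists>(p::nat) e' E' m'. real p * K > 1/2 \<and> kernel_pair (real p * K) e' E' m' \<and>
        (\<forall>\<rho>>0. \<forall>\<phi>. \<bar>\<phi>\<bar> < pi / (2 * K) \<longrightarrow>
           e \<rho> \<phi> = e' (complex_of_real (\<rho> powr (1 / real p)) * cis (\<phi> / real p)) / of_nat p) \<and>
        (\<forall>t. (\<lambda>n. t ^ n / m' (of_nat (p * n))) sums E t) \<and>
        (\<forall>u. Re u \<ge> 0 \<longrightarrow> m u = m' (of_nat p * u)))"

definition moment_function :: "real \<Rightarrow> (complex \<Rightarrow> complex) \<Rightarrow> bool" where
  "moment_function K m \<longleftrightarrow> (\<exists>e E. kernel_pair K e E m) \<or> (\<exists>e E. kernel_pair_small K e E m)"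

definition moment_sequence :: "(nat \<Rightarrow> complex) \<Rightarrow> bool" where
  "moment_sequence m \<longleftrightarrow> (\<exists>K>0. \<exists>M. moment_function K M \<and> (\<forall>n. m n = M (of_nat n)))"

text \<open>If \<open>u = \<Sum>n. a n / m n * z ^ n\<close>, then \<open>a n = m n * taylor_coeff u n\<close>.
  The resulting series has a positive radius of convergence whenever \<open>m\<close> is a sequence of moments,
  because then \<open>m (Suc n) / m n\<close> grows at most geometrically; for other \<open>m\<close> the value may be junk.\<close>

definition moment_deriv :: "(nat \<Rightarrow> complex) \<Rightarrow> germ \<Rightarrow> germ" where
  "moment_deriv m u =
     (let a = (\<lambda>n. m n * taylor_coeff u n) in abs_germ (\<lambda>z. \<Sum>n. a (Suc n) / m n * z ^ n))"

definition moment_op :: "(nat \<Rightarrow> complex) \<Rightarrow> germ poly \<Rightarrow> germ \<Rightarrow> germ" where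
  "moment_op m c u = (\<Sum>i\<le>degree c. coeff c i * (moment_deriv m ^^ i) u)"

definition moment_op_series :: "(nat \<Rightarrow> complex) \<Rightarrow> germ poly \<Rightarrow> germ fps \<Rightarrow> germ fps" where
  "moment_op_series m c x = Abs_fps (\<lambda>n. moment_op m c (fps_nth x n))"

text \<open>An element of \<^typ>\<open>germ poly poly\<close> is a polynomial in the outer variable whose coefficients are
  polynomials in \<open>\<zeta>\<close>. The outer variable is replaced by multiplication with \<open>\<epsilon>\<close>, respectively by
  differentiation with respect to \<open>\<epsilon>\<close>.\<close>

definition op_eps :: "(nat \<Rightarrow> complex) \<Rightarrow> germ poly poly \<Rightarrow> germ fps \<Rightarrow> germ fps" where
  "op_eps m P x = (\<Sum>j\<le>degree P. fps_X ^ j * moment_op_series m (coeff P j) x)"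

definition op_deriv_eps :: "(nat \<Rightarrow> complex) \<Rightarrow> germ poly poly \<Rightarrow> germ fps \<Rightarrow> germ fps" where
  "op_deriv_eps m Q y = (\<Sum>j\<le>degree Q. moment_op_series m (coeff Q j) ((fps_deriv ^^ j) y))"

definition borel_transform :: "germ fps \<Rightarrow> germ fps" where
  "borel_transform u = Abs_fps (\<lambda>n. fps_nth u n /\<^sub>R fact n)"

text \<open>For \<open>P\<close> of degree \<open>p\<close> in the outer variable, \<^term>\<open>reflect_poly P\<close> is \<open>\<chi> ^ p * P (\<chi>\<inverse>)\<close>,
  written out as follows.\<close>

lemma reflect_poly_altdef:
  fixes P :: "germ poly poly"
  shows "reflect_poly P = (\<Sum>j\<le>degree P. monom (coeff P j) (degree P - j))"
proof (rule poly_eqI)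
  fix n
  have "coeff (\<Sum>j\<le>degree P. monom (coeff P j) (degree P - j)) n =
      (\<Sum>j\<le>degree P. if degree P - j = n then coeff P j else 0)"
    by (simp add: coeff_sum)
  also have "\<dots> = (\<Sum>j\<le>degree P. if n \<le> degree P \<and> j = degree P - n then coeff P j else 0)"
    by (intro sum.cong) auto
  also have "\<dots> = coeff (reflect_poly P) n"
    by (cases "n \<le> degree P") (auto simp: coeff_reflect_poly)
  finally show "coeff (reflect_poly P) n = coeff (\<Sum>j\<le>degree P. monom (coeff P j) (degree P - j)) n" ..
qed

end

theory Submission
  imports Defs "HOL-Probability.Sinc_Integral" "HOL-Real_Asymp.Real_Asymp"
begin

text \<open>The coefficient of \<open>\<epsilon> ^ n\<close> in \<open>Q (\<partial>\<^sub>\<epsilon>, z, \<partial>\<^sub>m) y\<close> is \<open>1 / n!\<close> times the coefficient of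
  \<open>\<epsilon> ^ (n + p)\<close> in \<open>P (\<epsilon>, z, \<partial>\<^sub>m) x\<close>, and the same holds for \<open>F\<close> and \<open>f\<close>; the first \<open>p\<close>
  coefficients are the displayed equations for \<open>x\<^sub>0, \<dots>, x\<^sub>p\<^sub>-\<^sub>1\<close>. Pulling the factor \<open>1 / n!\<close> out of
  \<open>\<partial>\<^sub>m\<close> is legitimate only if \<open>\<partial>\<^sub>m\<close> maps germs to germs rather than to the junk value of
  \<^const>\<open>abs_germ\<close>, so the quotients \<open>m (n + 1) / m n\<close> have to be bounded geometrically.\<close>

unbundle no vec_syntax

section \<open>Growth of moments\<close>

lemma integrable_inverse_1_plus_square_UNIV:
  "integrable lborel (\<lambda>x::real. inverse (1 + x\<^sup>2))"
  using integrable_inverse_1_plus_square by (simp add: set_integrable_def)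

text \<open>Since \<open>x \<ge> 2 ^ n\<close> forces \<open>n\<close> to be at most the binary
  logarithm of \<open>x\<close>, the power is at most the exponential of a quadratic in
  \<open>ln x\<close>, which loses to \<open>(x / L) powr K\<close>. So \<open>B\<close> need not
  depend on \<open>n\<close>.\<close>

lemma power_times_exp_neg_powr_bound:
  fixes L K :: real
  assumes "L > 0" "K > 0"
  obtains B where "B \<ge> 0"
    "\<And>n x. x \<ge> 2 ^ n \<Longrightarrow> x ^ (q * Suc n) * exp (- ((x / L) powr K)) \<le> B * inverse (1 + x\<^sup>2)"
proof -
  define Q where "Q = real q"
  \<comment> \<open>Putting the largest admissible \<open>n\<close> eliminates it; the factor
    \<open>1 + x\<^sup>2\<close> turns boundedness of \<open>h\<close> into an integrable
    majorant.\<close>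
  define h where "h x = exp (Q * (ln x / ln 2 + 1) * ln x - (x / L) powr K) * (1 + x\<^sup>2)" for x
  have "(h \<longlongrightarrow> 0) at_top"
    unfolding h_def using assms by real_asymp
  then have "eventually (\<lambda>x. h x < 1) at_top"
    by (rule order_tendstoD) simp
  then obtain X where X: "\<And>x. x \<ge> X \<Longrightarrow> h x < 1"
    by (auto simp: eventually_at_top_linorder)
  have "continuous_on {1..X} h"
    unfolding h_def using assms by (intro continuous_intros) auto
  then have "bounded (h ` {1..X})"
    by (intro compact_imp_bounded compact_continuous_image) auto
  then obtain b where b: "\<And>x. x \<in> {1..X} \<Longrightarrow> \<bar>h x\<bar> \<le> b"
    unfolding bounded_iff real_norm_def by blast
  \<comment> \<open>\<open>1\<close> serves beyond \<open>X\<close>, where the limit of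
    \<open>h\<close> takes effect, and \<open>b\<close> on the compact interval up to
    \<open>X\<close>.\<close>
  define B where "B = max 1 b"
  have h_le: "h x \<le> B" if "x \<ge> 1" for x
    using X[of x] b[of x] that by (cases "x \<ge> X") (auto simp: B_def)
  show ?thesis
  proof (rule that[of B])
    show "B \<ge> 0" by (simp add: B_def)
    fix n and x :: real assume x: "x \<ge> 2 ^ n"
    have x1: "x \<ge> 1" using x one_le_power[of "2::real" n] by linarith
    have "real n * ln 2 = ln (2 ^ n)" by (simp add: ln_realpow)
    also have "\<dots> \<le> ln x" using x x1 by (intro ln_mono) auto
    finally have n: "real n \<le> ln x / ln 2" by (simp add: field_simps)
    have "x ^ (q * Suc n) = exp (real (q * Suc n) * ln x)"
      using x1 by (subst exp_of_nat_mult) simp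
    also have "\<dots> \<le> exp (Q * (ln x / ln 2 + 1) * ln x)"
      using n x1 unfolding Q_def
      by (simp only: exp_le_cancel_iff of_nat_mult of_nat_Suc) (intro mult_right_mono mult_left_mono; simp)
    finally have "x ^ (q * Suc n) * exp (- ((x / L) powr K)) * (1 + x\<^sup>2) \<le> h x"
      unfolding h_def diff_conv_add_uminus exp_add by (intro mult_right_mono) auto
    also have "\<dots> \<le> B" by (rule h_le[OF x1])
    finally show "x ^ (q * Suc n) * exp (- ((x / L) powr K)) \<le> B * inverse (1 + x\<^sup>2)"
      by (simp add: field_simps add_pos_nonneg)
  qed
qed

text \<open>Splitting the integral for the larger moment at \<open>2 ^ n\<close>: below, the extra factor \<open>x ^ q\<close> is at
  most \<open>2 ^ (q * n)\<close>; above, \<open>n \<le> log 2 x\<close> makes the integrand bounded by one integrable function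
  for all \<open>n\<close> at once.\<close>

lemma moment_integral_growth:
  fixes w :: "real \<Rightarrow> real" and L K c :: real
  defines "I \<equiv> \<lambda>N. LBINT x:{0<..}. x ^ N * w x"
  assumes cont: "continuous_on {0<..} w" and pos: "\<And>x. x > 0 \<Longrightarrow> w x > 0"
    and int0: "set_integrable lborel {0<..1} w"
    and decay: "\<And>x. x \<ge> 1 \<Longrightarrow> w x \<le> c * exp (- ((x / L) powr K))"
    and LK: "L > 0" "K > 0" and c: "c > 0"
  obtains C A where "A > 0" "\<And>n. I (q * n) > 0" "\<And>n. I (q * Suc n) \<le> C * A ^ n * I (q * n)"
proof -
  \<comment> \<open>Stated for every \<open>q\<close>: with \<open>n = 0\<close> it yields
    integrability of all moments, and with the given \<open>q\<close> it controls the part above the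
    cut at \<open>2 ^ n\<close>.\<close>
  have tail: "\<exists>B\<ge>0. \<forall>n x. x \<ge> 2 ^ n \<longrightarrow> x ^ (q * Suc n) * w x \<le> B * inverse (1 + x\<^sup>2)" for q
  proof -
    obtain B where B: "B \<ge> 0" "\<And>n x. x \<ge> 2 ^ n \<Longrightarrow> x ^ (q * Suc n) * exp (- ((x / L) powr K)) \<le> B * inverse (1 + x\<^sup>2)"
      using power_times_exp_neg_powr_bound[OF LK, of q] by blast
    have "x ^ (q * Suc n) * w x \<le> (c * B) * inverse (1 + x\<^sup>2)" if x: "x \<ge> 2 ^ n" for n x
    proof -
      have x1: "x \<ge> 1" using x one_le_power[of "2::real" n] by linarith
      have "x ^ (q * Suc n) * w x \<le> x ^ (q * Suc n) * (c * exp (- ((x / L) powr K)))"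
        using x1 by (intro mult_left_mono decay) auto
      also have "\<dots> = c * (x ^ (q * Suc n) * exp (- ((x / L) powr K)))" by simp
      also have "\<dots> \<le> c * (B * inverse (1 + x\<^sup>2))"
        using c by (intro mult_left_mono B x) auto
      finally show ?thesis by simp
    qed
    then show ?thesis using B c by (intro exI[of _ "c * B"]) auto
  qed
  have int: "set_integrable lborel {0<..} (\<lambda>x. x ^ N * w x)" for N
  proof -
    obtain B where B: "B \<ge> 0" "\<And>x. x \<ge> 1 \<Longrightarrow> x ^ N * w x \<le> B * inverse (1 + x\<^sup>2)"
      using tail[of N] by (auto dest: spec[of _ 0])
    show ?thesis
      unfolding set_integrable_def
    proof (rule Bochner_Integration.integrable_bound)
      \<comment> \<open>On (0,1] the power is at most 1 and \<open>w\<close> dominates; beyond 1 the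
        tail bound does.\<close>
      show "integrable lborel (\<lambda>x. indicator {0<..1} x *\<^sub>R w x + B * inverse (1 + x\<^sup>2))"
        using int0 integrable_inverse_1_plus_square_UNIV
        by (intro Bochner_Integration.integrable_add integrable_mult_right) (auto simp: set_integrable_def)
      show "(\<lambda>x. indicator {0<..} x *\<^sub>R (x ^ N * w x)) \<in> borel_measurable lborel"
        unfolding measurable_lborel2
        by (rule borel_measurable_continuous_on_indicator) (auto intro!: continuous_intros cont)
      show "AE x in lborel. norm (indicator {0<..} x *\<^sub>R (x ^ N * w x))
          \<le> norm (indicator {0<..1} x *\<^sub>R w x + B * inverse (1 + x\<^sup>2))"
      proof (rule AE_I2)
        fix x :: real
        have P: "B * inverse (1 + x\<^sup>2) \<ge> 0" using B by (simp add: add_nonneg_nonneg)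
        consider "x \<le> 0" | "0 < x" "x \<le> 1" | "x > 1" by linarith
        then show "norm (indicator {0<..} x *\<^sub>R (x ^ N * w x))
            \<le> norm (indicator {0<..1} x *\<^sub>R w x + B * inverse (1 + x\<^sup>2))"
        proof cases
          case 2
          then have "x ^ N * w x \<le> 1 * w x"
            using pos[of x] by (intro mult_right_mono power_le_one) auto
          then have "x ^ N * w x \<le> w x + B * inverse (1 + x\<^sup>2)" using P by linarith
          then show ?thesis using 2 P pos[of x] by (simp add: abs_mult)
        next
          case 3
          then show ?thesis using P pos[of x] B(1) B(2)[of x] by (simp add: abs_mult)
        qed auto
      qed
    qed
  qed
  \<comment> \<open>The minimum of \<open>w\<close> on [1,2], where \<open>x ^ N \<ge> 1\<close>, is
    a positive lower bound for all moments at once; it will absorb the additive tail error.\<close>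
  have "\<exists>\<mu>\<in>{1..2}. \<forall>y\<in>{1..2}. w \<mu> \<le> w y"
    by (rule continuous_attains_inf) (auto intro: continuous_on_subset[OF cont])
  then obtain \<mu> where \<mu>: "\<mu> > 0" "\<And>y. y \<in> {1..2} \<Longrightarrow> \<mu> \<le> w y"
    using pos by (metis atLeastAtMost_iff less_le_trans zero_less_one)
  have lower: "I N \<ge> \<mu>" for N
  proof -
    have "\<mu> = (\<integral>x. indicator {1..2::real} x *\<^sub>R \<mu> \<partial>lborel)" by simp
    also have "\<dots> \<le> I N"
      unfolding I_def set_lebesgue_integral_def
    proof (rule integral_mono)
      show "integrable lborel (\<lambda>x. indicator {1..2::real} x *\<^sub>R \<mu>)" by simp
      show "integrable lborel (\<lambda>x. indicator {0<..} x *\<^sub>R (x ^ N * w x))"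
        using int[of N] by (simp add: set_integrable_def)
      fix x :: real
      have "1 * \<mu> \<le> x ^ N * w x" if "x \<in> {1..2}"
        using that \<mu> by (intro mult_mono) (auto simp: one_le_power)
      then show "indicator {1..2} x *\<^sub>R \<mu> \<le> indicator {0<..} x *\<^sub>R (x ^ N * w x)"
        using pos[of x] by (auto simp: indicator_def)
    qed
    finally show ?thesis .
  qed
  obtain B where B: "B \<ge> 0" "\<And>n x. x \<ge> 2 ^ n \<Longrightarrow> x ^ (q * Suc n) * w x \<le> B * inverse (1 + x\<^sup>2)"
    using tail[of q] by blast
  define J where "J = (\<integral>x. inverse (1 + x\<^sup>2) \<partial>(lborel :: real measure))"
  have J: "J \<ge> 0" unfolding J_def by (rule Bochner_Integration.integral_nonneg) simp
  have upper: "I (q * Suc n) \<le> (2 ^ q) ^ n * I (q * n) + B * J" for n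
  proof -
    let ?g = "\<lambda>x. (2 ^ q) ^ n * (indicator {0<..} x *\<^sub>R (x ^ (q * n) * w x)) + B * inverse (1 + x\<^sup>2)"
    have "I (q * Suc n) \<le> (\<integral>x. ?g x \<partial>lborel)"
      unfolding I_def set_lebesgue_integral_def
    proof (rule integral_mono)
      show "integrable lborel (\<lambda>x. indicator {0<..} x *\<^sub>R (x ^ (q * Suc n) * w x))"
        using int[of "q * Suc n"] by (simp add: set_integrable_def)
      show "integrable lborel ?g"
        using int[of "q * n"] integrable_inverse_1_plus_square_UNIV
        by (intro Bochner_Integration.integrable_add integrable_mult_right) (auto simp: set_integrable_def)
      fix x :: real
      have P: "B * inverse (1 + x\<^sup>2) \<ge> 0" using B by (simp add: add_nonneg_nonneg)
      consider "x \<le> 0" | "0 < x" "x \<le> 2 ^ n" | "x > 2 ^ n" "x > 0"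
        using zero_less_power[of "2::real" n] by linarith
      then show "indicator {0<..} x *\<^sub>R (x ^ (q * Suc n) * w x) \<le> ?g x"
      proof cases
        case 2
        have "x ^ (q * Suc n) * w x = x ^ q * (x ^ (q * n) * w x)" by (simp add: power_add)
        also have "\<dots> \<le> (2 ^ n) ^ q * (x ^ (q * n) * w x)"
          using 2 pos[of x] by (intro mult_right_mono power_mono) auto
        also have "(2 ^ n) ^ q = ((2 ^ q) ^ n :: real)" by (simp flip: power_mult add: mult.commute)
        finally show ?thesis using 2 P by simp
      next
        case 3
        have "(2 ^ q) ^ n * (x ^ (q * n) * w x) \<ge> 0" using 3 pos[of x] by simp
        then show ?thesis using 3 B(2)[of n x] by (simp del: mult_Suc_right)
      qed (use P in auto)
    qed
    also have "\<dots> = (2 ^ q) ^ n * I (q * n) + B * J"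
      unfolding I_def J_def set_lebesgue_integral_def
      using int[of "q * n"] integrable_inverse_1_plus_square_UNIV
      by (subst Bochner_Integration.integral_add) (auto simp: set_integrable_def)
    finally show ?thesis .
  qed
  show ?thesis
  \<comment> \<open>\<open>2 ^ q\<close> comes from the part below the cut. As
    \<open>I (q * n) \<ge> \<mu>\<close> and \<open>(2 ^ q) ^ n \<ge> 1\<close>, the additive
    \<open>B * J\<close> costs at most \<open>B * J / \<mu>\<close> in the constant.\<close>
  proof (rule that[of "2 ^ q" "1 + B * J / \<mu>"])
    show "I (q * n) > 0" for n using lower[of "q * n"] \<mu> by linarith
    show "I (q * Suc n) \<le> (1 + B * J / \<mu>) * (2 ^ q) ^ n * I (q * n)" for n
    proof -
      have "B * J = (B * J / \<mu>) * 1 * \<mu>" using \<mu> by simp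
      also have "\<dots> \<le> (B * J / \<mu>) * (2 ^ q) ^ n * I (q * n)"
        using \<mu> B J lower[of "q * n"] by (intro mult_mono mult_nonneg_nonneg) (auto simp: one_le_power)
      finally show ?thesis using upper[of n] by (simp add: algebra_simps)
    qed
  qed simp
qed

text \<open>On the positive axis \<open>e\<close> is a positive weight, so the integral estimate
  applies. The stride \<open>q\<close> serves orders K \<le> 1/2, where the moments are every q-th
  moment of another kernel.\<close>

lemma kernel_pair_moment_growth:
  assumes "kernel_pair K e E M"
  obtains C A where "A > 0"
    "\<And>n. cmod (M (of_nat (q * Suc n))) \<le> C * A ^ n * cmod (M (of_nat (q * n)))"
proof -
  define g where "g x = Re (e (complex_of_real x))" for x
  \<comment> \<open>The exponent \<open>u - 1\<close> in \<open>mellin\<close> contributes the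
    factor \<open>1 / x\<close>; integrability at the origin concerns exactly this quotient.\<close>
  define w where "w x = g x / x" for x
  have K: "K > 1/2" and hol: "e holomorphic_on sector 0 (pi / K)"
    and int: "integrable_at_origin 0 (pi / K) e"
    and dec: "\<forall>\<delta>>0. \<exists>c>0. \<exists>L>0. \<forall>t. t \<noteq> 0 \<and> 2 * K * \<bar>Arg t\<bar> \<le> pi - \<delta> \<longrightarrow>
        cmod (e t) \<le> c * exp (- ((cmod t / L) powr K))"
    and pos: "\<And>x. x > 0 \<Longrightarrow> e (complex_of_real x) \<in> \<real> \<and> Re (e (complex_of_real x)) > 0"
    and mel: "\<And>u. Re u \<ge> 0 \<Longrightarrow> M u = mellin e u"
    using assms unfolding kernel_pair_def by auto
  have sec: "complex_of_real x \<in> sector 0 (pi / K)" if "x > 0" for x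
    unfolding sector_def using that K by (intro CollectI exI[of _ x] exI[of _ 0]) auto
  have e_eq: "e (complex_of_real x) = of_real (g x)" if "x > 0" for x
    using pos[OF that] by (simp add: g_def of_real_Re)
  have gpos: "g x > 0" if "x > 0" for x using pos[OF that] by (simp add: g_def)
  have cont: "continuous_on {0<..} w"
  proof -
    have "continuous_on {0<..} (\<lambda>x. e (complex_of_real x))"
      by (rule continuous_on_compose2[OF holomorphic_on_imp_continuous_on[OF hol]])
         (auto intro!: continuous_intros sec)
    then show ?thesis unfolding w_def g_def by (intro continuous_intros) auto
  qed
  have wpos: "w x > 0" if "x > 0" for x using gpos[OF that] that by (simp add: w_def)
  have int0: "set_integrable lborel {0<..1} w"
  proof -
    have "set_integrable lborel {0<..1} (\<lambda>x. cmod (e (complex_of_real x * cis 0)) / x)"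
      using K by (intro int[unfolded integrable_at_origin_def, rule_format]) auto
    moreover have "cmod (e (complex_of_real x * cis 0)) / x = w x" if "x \<in> {0<..1}" for x
      using that gpos[of x] by (simp add: e_eq w_def)
    ultimately show ?thesis
      by (subst (asm) set_integrable_cong[OF refl refl]) auto
  qed
  \<comment> \<open>The choice \<open>\<delta> = pi\<close> restricts the decay estimate to the
    positive axis, where \<open>Arg t = 0\<close>.\<close>
  obtain c L where cL: "c > 0" "L > 0" "\<And>t. t \<noteq> 0 \<Longrightarrow> 2 * K * \<bar>Arg t\<bar> \<le> 0 \<Longrightarrow>
        cmod (e t) \<le> c * exp (- ((cmod t / L) powr K))"
    using dec[rule_format, OF pi_gt_zero] by auto
  have decay: "w x \<le> c * exp (- ((x / L) powr K))" if "x \<ge> 1" for x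
  proof -
    have "w x \<le> g x" using that gpos[of x] by (simp add: w_def field_simps)
    also have "\<dots> = cmod (e (complex_of_real x))" using that gpos[of x] by (simp add: e_eq)
    also have "\<dots> \<le> c * exp (- ((x / L) powr K))"
      using cL(3)[of "complex_of_real x"] that by (simp add: Arg_of_real)
    finally show ?thesis .
  qed
  have M_eq: "M (of_nat N) = of_real (LBINT x:{0<..}. x ^ N * w x)" for N
  proof -
    have "M (of_nat N) = (LBINT x:{0<..}. complex_of_real (x ^ N * w x))"
      unfolding mel[of "of_nat N", simplified] mellin_def
    proof (rule set_lebesgue_integral_cong)
      show "\<forall>x. x \<in> {0<..} \<longrightarrow> complex_of_real x powr (of_nat N - 1) * e (complex_of_real x)
          = complex_of_real (x ^ N * w x)"
        by (auto simp: e_eq w_def powr_diff powr_nat)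
    qed auto
    then show ?thesis by (simp only: set_integral_complex_of_real)
  qed
  have "K > 0" using K by simp
  from moment_integral_growth[OF cont wpos int0 decay cL(2) this cL(1)]
  obtain C A where "A > 0" "\<And>n. (LBINT x:{0<..}. x ^ (q * n) * w x) > 0"
    "\<And>n. (LBINT x:{0<..}. x ^ (q * Suc n) * w x) \<le> C * A ^ n * (LBINT x:{0<..}. x ^ (q * n) * w x)"
    by blast
  then show ?thesis
    by (intro that[of A C]) (simp_all only: M_eq norm_of_real abs_of_pos)
qed

lemma moment_sequence_growth:
  assumes "moment_sequence m"
  obtains C A where "A > 0" "\<And>n. cmod (m (Suc n)) \<le> C * A ^ n * cmod (m n)"
proof -
  obtain K M where M: "moment_function K M" "\<And>n. m n = M (of_nat n)"
    using assms by (auto simp: moment_sequence_def)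
  from M(1) consider e E where "kernel_pair K e E M" | e E where "kernel_pair_small K e E M"
    by (auto simp: moment_function_def)
  then show ?thesis
  proof cases
    case 1
    from kernel_pair_moment_growth[OF this, of 1] show ?thesis
      using that M(2) by (metis mult_1)
  next
    case 2
    then obtain q K' e' E' M' where "kernel_pair K' e' E' M'" "\<And>u. Re u \<ge> 0 \<Longrightarrow> M u = M' (of_nat q * u)"
      unfolding kernel_pair_small_def by blast
    with kernel_pair_moment_growth[OF this(1), of q] show ?thesis
      using that M(2) by (metis complex_Re_of_nat of_nat_0_le_iff of_nat_mult)
  qed
qed

section \<open>Homogeneity of the moment differential operator\<close>

text \<open>This is Cauchy's inequality for a representative on a closed disc of radius
  \<open>r\<close>, with \<open>A = 1 / r\<close>.\<close>

lemma taylor_coeff_bound: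
  obtains C A where "A > 0" "\<And>n. cmod (taylor_coeff u n) \<le> C * A ^ n"
proof -
  have "\<exists>C A. A > 0 \<and> (\<forall>n. cmod (taylor_coeff u n) \<le> C * A ^ n)"
  proof transfer
    fix f assume "germ_rel f f"
    then obtain r where r: "r > 0" "f holomorphic_on ball 0 r" "continuous_on (cball 0 r) f"
      by (auto simp: germ_rel_def hol_near_0_iff)
    have "bounded (f ` cball 0 r)"
      by (intro compact_imp_bounded compact_continuous_image r) auto
    then obtain B where B: "\<And>x. x \<in> cball 0 r \<Longrightarrow> cmod (f x) \<le> B"
      unfolding bounded_iff by blast
    have "cmod ((deriv ^^ n) f 0 / fact n) \<le> B * (1 / r) ^ n" for n
      using Cauchy_inequality[OF r(2,3,1), of B n] B
      by (simp add: norm_divide field_simps)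
    with r(1) show "\<exists>C A. A > 0 \<and> (\<forall>n. cmod ((deriv ^^ n) f 0 / fact n) \<le> C * A ^ n)"
      by (intro exI[of _ B] exI[of _ "1 / r"]) auto
  qed
  then show ?thesis using that by blast
qed

lemma taylor_coeff_scaleR: "taylor_coeff (c *\<^sub>R u) n = of_real c * taylor_coeff u n"
proof transfer
  fix c :: real and f :: "complex \<Rightarrow> complex" and n
  assume "germ_rel f f"
  then obtain r where "r > 0" "f holomorphic_on ball 0 r"
    by (auto simp: germ_rel_def hol_near_0_iff)
  then show "(deriv ^^ n) (\<lambda>z. c *\<^sub>R f z) 0 / fact n = of_real c * ((deriv ^^ n) f 0 / fact n)"
    by (simp add: scaleR_conv_of_real higher_deriv_cmult[where A = "ball 0 r"])
qed

lemma summable_power_series_geometric: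
  fixes b :: "nat \<Rightarrow> complex"
  assumes "A > 0" "\<And>n. cmod (b n) \<le> C * A ^ n" "z \<in> ball 0 (1 / A)"
  shows "summable (\<lambda>n. b n * z ^ n)"
proof (rule summable_comparison_test')
  show "summable (\<lambda>n. C * (A * cmod z) ^ n)"
    using assms by (intro summable_mult summable_geometric) (auto simp: field_simps)
  show "norm (b n * z ^ n) \<le> C * (A * cmod z) ^ n" for n
    using mult_right_mono[OF assms(2)[of n], of "cmod z ^ n"]
    by (simp add: norm_mult norm_power power_mult_distrib mult.assoc)
qed

lemma power_series_hol_near_0:
  fixes b :: "nat \<Rightarrow> complex"
  assumes "A > 0" "\<And>n. cmod (b n) \<le> C * A ^ n"
  shows "(\<lambda>z. \<Sum>n. b n * z ^ n) \<in> hol_near_0"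
proof -
  have "(\<lambda>z. \<Sum>n. b n * z ^ n) holomorphic_on ball 0 (1 / A)"
    by (rule power_series_holomorphic[of 0 _ b])
       (use summable_sums[OF summable_power_series_geometric[OF assms]] in auto)
  \<comment> \<open>Halving the radius puts the closed disc inside the open disc of convergence,
    which gives continuity up to the boundary.\<close>
  moreover have "cball 0 (1 / (2 * A)) \<subseteq> ball (0 :: complex) (1 / A)"
    using assms(1) by (auto simp: field_simps)
  ultimately have "(\<lambda>z. \<Sum>n. b n * z ^ n) holomorphic_on cball 0 (1 / (2 * A))"
    by (rule holomorphic_on_subset)
  then have "(\<lambda>z. \<Sum>n. b n * z ^ n) holomorphic_on ball 0 (1 / (2 * A))"
    "continuous_on (cball 0 (1 / (2 * A))) (\<lambda>z. \<Sum>n. b n * z ^ n)"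
    by (auto intro: holomorphic_on_subset holomorphic_on_imp_continuous_on)
  then show ?thesis
    unfolding hol_near_0_iff using assms(1) by (intro exI[of _ "1 / (2 * A)"]) simp
qed

text \<open>Geometric bounds on the moment quotients and on the Taylor coefficients multiply, so the
  series defining \<open>moment_deriv\<close> represents a germ and the scalar can pass through
  \<open>abs_germ\<close>.\<close>

lemma moment_deriv_scaleR:
  assumes "moment_sequence m"
  shows "moment_deriv m (c *\<^sub>R u) = c *\<^sub>R moment_deriv m u"
proof -
  define b where "b n = m (Suc n) * taylor_coeff u (Suc n) / m n" for n
  obtain C A where CA: "A > 0" "\<And>n. cmod (m (Suc n)) \<le> C * A ^ n * cmod (m n)"
    using moment_sequence_growth[OF assms] by blast
  obtain C' A' where CA': "A' > 0" "\<And>n. cmod (taylor_coeff u n) \<le> C' * A' ^ n"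
    using taylor_coeff_bound by blast
  have C': "C' \<ge> 0" using order_trans[OF norm_ge_zero CA'(2)[of 0]] by simp
  have b: "cmod (b n) \<le> (\<bar>C\<bar> * C' * A') * (A * A') ^ n" for n
  proof -
    have "cmod (m (Suc n)) / cmod (m n) \<le> \<bar>C\<bar> * A ^ n"
    \<comment> \<open>For \<open>m n = 0\<close> the quotient is 0 by the convention for
      division.\<close>
    proof (cases "m n = 0")
      case False
      then have "cmod (m (Suc n)) / cmod (m n) \<le> C * A ^ n"
        using CA(2)[of n] by (simp add: divide_le_eq)
      also have "\<dots> \<le> \<bar>C\<bar> * A ^ n" using CA(1) by (intro mult_right_mono) auto
      finally show ?thesis .
    qed (use CA(1) in auto)
    then have "cmod (m (Suc n)) / cmod (m n) * cmod (taylor_coeff u (Suc n))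
        \<le> (\<bar>C\<bar> * A ^ n) * (C' * A' ^ Suc n)"
      using CA(1) by (intro mult_mono CA') auto
    then show ?thesis
      by (simp add: b_def norm_mult norm_divide power_mult_distrib mult_ac)
  qed
  have AA: "A * A' > 0" using CA CA' by simp
  let ?F = "\<lambda>z. \<Sum>n. b n * z ^ n"
  have F: "germ_rel ?F ?F"
    using power_series_hol_near_0[OF AA b] by (simp add: germ_rel_def)
  have "eventually (\<lambda>z. z \<in> ball 0 (1 / (A * A'))) (nhds (0 :: complex))"
    using AA by (intro eventually_nhds_in_open) auto
  \<comment> \<open>The scalar leaves the infinite sum where the series converges; equality on that
    disc suffices for germs.\<close>
  then have "\<forall>\<^sub>F z in nhds 0. (\<Sum>n. (of_real c * b n) * z ^ n) = c *\<^sub>R ?F z"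
    by eventually_elim
       (simp add: scaleR_conv_of_real mult.assoc suminf_mult summable_power_series_geometric[OF AA b])
  moreover have "(\<lambda>z. \<Sum>n. (of_real c * b n) * z ^ n) \<in> hol_near_0"
  proof (rule power_series_hol_near_0[OF AA])
    show "cmod (of_real c * b n) \<le> (\<bar>c\<bar> * (\<bar>C\<bar> * C' * A')) * (A * A') ^ n" for n
      using mult_left_mono[OF b[of n], of "\<bar>c\<bar>"] by (simp add: norm_mult mult.assoc)
  qed
  ultimately have "germ_rel (\<lambda>z. \<Sum>n. (of_real c * b n) * z ^ n) (\<lambda>z. c *\<^sub>R ?F z)"
    using F by (simp add: germ_rel_def hol_near_0_scaleR)
  then have "abs_germ (\<lambda>z. \<Sum>n. (of_real c * b n) * z ^ n) = abs_germ (\<lambda>z. c *\<^sub>R ?F z)"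
    using Quotient_rel_abs[OF Quotient_germ] by blast
  also have "\<dots> = c *\<^sub>R abs_germ ?F"
    using scaleR_germ.abs_eq[OF F] by simp
  finally show ?thesis
    by (simp add: moment_deriv_def Let_def taylor_coeff_scaleR b_def mult_ac)
qed

lemma moment_op_scaleR:
  assumes "moment_sequence m"
  shows "moment_op m P (c *\<^sub>R u) = c *\<^sub>R moment_op m P u"
proof -
  have "(moment_deriv m ^^ i) (c *\<^sub>R u) = c *\<^sub>R (moment_deriv m ^^ i) u" for i
    by (induction i) (simp_all add: moment_deriv_scaleR[OF assms])
  then show ?thesis by (simp add: moment_op_def scaleR_sum_right)
qed

lemma moment_op_0 [simp]: "moment_op m 0 u = 0"
  by (simp add: moment_op_def)

section \<open>Comparison of coefficients\<close>

text \<open>The factor \<open>n + 1\<close> from differentiation reduces \<open>1 / (n + 1)!\<close>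
  to \<open>1 / n!\<close>, leaving a pure shift.\<close>

lemma fps_deriv_borel_transform:
  "fps_deriv (borel_transform u) = borel_transform (fps_shift 1 u)"
proof (rule fps_ext)
  fix n
  have "of_nat (Suc n) * g = real (Suc n) *\<^sub>R g" for g :: germ
    by (metis of_real_of_nat_eq scaleR_conv_of_real)
  then show "fps_deriv (borel_transform u) $ n = borel_transform (fps_shift 1 u) $ n"
    by (simp add: borel_transform_def del: of_nat_Suc)
qed

lemma fps_deriv_funpow_borel_transform:
  "(fps_deriv ^^ j) (borel_transform u) = borel_transform (fps_shift j u)"
  by (induction j) (simp_all add: fps_deriv_borel_transform flip: fps_shift_fps_shift)

text \<open>Indexing the convolution by the position in \<open>x\<close> gives it the shape of the
  displayed equations for the initial data.\<close>

lemma op_eps_nth: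
  "op_eps m P x $ n = (\<Sum>k\<le>n. moment_op m (coeff P (n - k)) (x $ k))"
proof -
  have "op_eps m P x $ n = (\<Sum>j\<le>degree P. if j \<le> n then moment_op m (coeff P j) (x $ (n - j)) else 0)"
    by (auto simp: op_eps_def fps_sum_nth fps_X_power_mult_nth moment_op_series_def intro!: sum.cong)
  also have "\<dots> = (\<Sum>j\<le>n. moment_op m (coeff P j) (x $ (n - j)))"
    by (rule sum.mono_neutral_cong) (auto simp: coeff_eq_0)
  also have "\<dots> = (\<Sum>k\<le>n. moment_op m (coeff P (n - k)) (x $ k))"
    by (rule sum.reindex_bij_witness[of _ "\<lambda>k. n - k" "\<lambda>k. n - k"]) auto
  finally show ?thesis .
qed

text \<open>The j-fold derivative shifts \<open>x\<close> by \<open>j\<close> and meets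
  \<open>coeff P (p - j)\<close>, where \<open>p = degree P\<close>; with \<open>k = n + j\<close>
  the two indices add up to \<open>n + p\<close>. Homogeneity of \<open>moment_op\<close> releases
  the common factor \<open>1 / n!\<close>.\<close>

lemma op_deriv_eps_borel_transform_nth:
  assumes "moment_sequence m"
  shows "op_deriv_eps m (reflect_poly P) (borel_transform x) $ n
    = op_eps m P x $ (n + degree P) /\<^sub>R fact n"
proof -
  let ?p = "degree P"
  have "op_deriv_eps m (reflect_poly P) (borel_transform x) $ n
      = (\<Sum>j\<le>degree (reflect_poly P). moment_op m (coeff (reflect_poly P) j) (x $ (n + j)) /\<^sub>R fact n)"
    by (simp add: op_deriv_eps_def fps_sum_nth moment_op_series_def fps_deriv_funpow_borel_transform)
       (simp add: borel_transform_def moment_op_scaleR[OF assms])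
  \<comment> \<open>When \<open>coeff P 0 = 0\<close> the reflected polynomial has degree below
    \<open>?p\<close>; the added terms vanish.\<close>
  also have "\<dots> = (\<Sum>j\<le>?p. moment_op m (coeff (reflect_poly P) j) (x $ (n + j)) /\<^sub>R fact n)"
    using degree_reflect_poly_le[of P] by (intro sum.mono_neutral_left) (auto simp: coeff_eq_0)
  also have "\<dots> = (\<Sum>k\<in>{n..n + ?p}. moment_op m (coeff P (n + ?p - k)) (x $ k) /\<^sub>R fact n)"
    by (rule sum.reindex_bij_witness[of _ "\<lambda>k. k - n" "\<lambda>j. n + j"]) (auto simp: coeff_reflect_poly)
  \<comment> \<open>For \<open>k < n\<close> the index \<open>n + ?p - k\<close> exceeds the degree
    of \<open>P\<close>.\<close>
  also have "\<dots> = (\<Sum>k\<le>n + ?p. moment_op m (coeff P (n + ?p - k)) (x $ k) /\<^sub>R fact n)"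
    by (intro sum.mono_neutral_left) (auto simp: coeff_eq_0)
  also have "\<dots> = op_eps m P x $ (n + ?p) /\<^sub>R fact n"
    by (simp add: op_eps_nth scaleR_sum_right)
  finally show ?thesis .
qed

theorem theorem4:
  fixes m :: "nat \<Rightarrow> complex" and P :: "germ poly poly" and p :: nat and f x :: "germ fps"
  assumes "moment_sequence m"
    and "degree P = p"
  shows "op_eps m P x = f \<longleftrightarrow>
    (let y = borel_transform x;
         Q = reflect_poly P;
         F = (fps_deriv ^^ p) (borel_transform f)
     in op_deriv_eps m Q y = F \<and>
        (\<forall>n<p. fps_nth ((fps_deriv ^^ n) y) 0 = fps_nth x n) \<and>
        (\<forall>n<p. (\<Sum>k\<le>n. moment_op m (coeff P (n - k)) (fps_nth x k)) = fps_nth f n))"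
proof -
  have "(fps_deriv ^^ p) (borel_transform f) $ n = f $ (n + p) /\<^sub>R fact n" for n
    by (simp add: fps_deriv_funpow_borel_transform) (simp add: borel_transform_def)
  then have "op_deriv_eps m (reflect_poly P) (borel_transform x) = (fps_deriv ^^ p) (borel_transform f)
      \<longleftrightarrow> (\<forall>n. op_eps m P x $ (n + p) = f $ (n + p))"
    using assms by (simp add: fps_eq_iff op_deriv_eps_borel_transform_nth)
  moreover have "op_eps m P x = f \<longleftrightarrow>
      (\<forall>n. op_eps m P x $ (n + p) = f $ (n + p)) \<and> (\<forall>n<p. op_eps m P x $ n = f $ n)"
    unfolding fps_eq_iff by (metis le_add_diff_inverse2 not_less)
  \<comment> \<open>The initial values come from coefficient 0 of
    \<open>borel_transform (fps_shift n x)\<close>, which is \<open>x $ n\<close> divided by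
    \<open>0! = 1\<close>.\<close>
  ultimately show ?thesis
    by (simp add: Let_def op_eps_nth fps_deriv_funpow_borel_transform) (simp add: borel_transform_def)
qed

end
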